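(* Let $r\ge 1$ and $k\ge 2$ be integers and let $\mathbf a=(a_1,\dots,a_r)$ be a sequence of positive integers. Then for every integer $n\ge 0$, the polynomial part $P_{k,\mathbf a}$ of the restricted $k$-multipartition function satisfies $$P_{k,\mathbf a}(n)=\frac{1}{(a_1\cdots a_r)^k}\sum_{u=0}^{rk-1}\frac{(-1)^u}{(rk-1-u)!}\,n^{rk-1-u}\sum_{\ell_1+\cdots+\ell_r=u}a_1^{\ell_1}\cdots a_r^{\ell_r}\sum_{\substack{i_1+\cdots+i_k=\ell_1\\ i_{k+1}+\cdots+i_{2k}=\ell_2\\ \vdots\\ i_{rk-k+1}+\cdots+i_{rk}=\ell_r}}\frac{B_{i_1}\cdots B_{i_{rk}}}{i_1!\cdots i_{rk}!},$$ where the $\ell_s$ and the $i_q$ range over nonnegative integers and $B_i$ are the Bernoulli numbers.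
   Context: For integers $n\ge 0$, the restricted $k$-multipartition function $p_{k,\mathbf a}(n)$ is the number of $k$-tuples $(x^1,\dots,x^k)$ of vectors $x^j=(x^j_1,\dots,x^j_r)\in\mathbb N^r$ (with $0\in\mathbb N$) such that $\sum_{j=1}^k\sum_{i=1}^r a_i x^j_i=n$; its generating function is $\prod_{i=1}^r(1-z^{a_i})^{-k}$. The polynomial part $P_{k,\mathbf a}(n)$ of $p_{k,\mathbf a}(n)$ is its first Sylvester wave, i.e. the coefficient of $t^{-1}$ in the Laurent expansion at $t=0$ of $$\frac{e^{nt}}{(1-e^{-a_1t})^k\cdots(1-e^{-a_rt})^k}.$$ The Bernoulli numbers are given by $\frac{t}{e^t-1}=\sum_{i\ge 0}B_i\frac{t^i}{i!}$ (so $B_1=-\tfrac12$). The convention $0^0=1$ is used. *)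

theory Defs
  imports "HOL-Complex_Analysis.Complex_Analysis"
begin

text \<open>
  The Bernoulli numbers with exponential generating function $t / (e^t - 1)$. Numerator and
  denominator both have subdegree 1, so the quotient is the usual power series, see
  \<open>bernoulli_generating_function\<close> below.
\<close>

definition bernoulli :: "nat \<Rightarrow> real" where
  "bernoulli i = fact i * fps_nth (fps_X / (fps_exp 1 - 1)) i"

lemma bernoulli_generating_function:
  "Abs_fps (\<lambda>i. bernoulli i / fact i) * (fps_exp 1 - 1) = fps_X"
proof -
  have nz: "(fps_exp 1 - 1 :: real fps) \<noteq> 0"
  proof
    assume "(fps_exp 1 - 1 :: real fps) = 0"
    then have "fps_nth (fps_exp 1 - 1 :: real fps) 1 = 0" by simp
    then show False by simp
  qed
  have "subdegree (fps_exp 1 - 1 :: real fps) = 1"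
    by (rule subdegreeI) auto
  then have "(fps_exp 1 - 1 :: real fps) dvd fps_X"
    using nz by (simp add: fps_dvd_iff)
  moreover have "Abs_fps (\<lambda>i. bernoulli i / fact i) = fps_X / (fps_exp 1 - 1)"
    by (simp add: bernoulli_def fps_eq_iff)
  ultimately show ?thesis by simp
qed

lemma bernoulli_0: "bernoulli 0 = 1"
proof -
  have "fps_nth (Abs_fps (\<lambda>i. bernoulli i / fact i) * (fps_exp 1 - 1)) 1 = 1"
    by (subst bernoulli_generating_function) simp
  then show ?thesis by (simp add: fps_mult_nth)
qed

lemma bernoulli_1: "bernoulli 1 = - 1 / 2"
proof -
  have "fps_nth (Abs_fps (\<lambda>i. bernoulli i / fact i) * (fps_exp 1 - 1)) 2 = 0"
    by (subst bernoulli_generating_function) simp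
  then show ?thesis by (simp add: fps_mult_nth numeral_2_eq_2 bernoulli_0)
qed

text \<open>
  The polynomial part (first Sylvester wave) of the restricted \<open>k\<close>-multipartition function of
  \<open>a 1, \<dots>, a r\<close>; only the values of \<open>a\<close> on \<open>{1..r}\<close> matter.
\<close>

definition polynomial_part :: "nat \<Rightarrow> nat \<Rightarrow> (nat \<Rightarrow> nat) \<Rightarrow> nat \<Rightarrow> complex" where
  "polynomial_part k r a n =
     fls_nth (laurent_expansion
       (\<lambda>t. exp (of_nat n * t) / (\<Prod>i=1..r. (1 - exp (- (of_nat (a i) * t))) ^ k)) 0) (-1)"

text \<open>The tuples \<open>(\<ell> 1, \<dots>, \<ell> r)\<close> of naturals with sum \<open>u\<close>, as extensional functions.\<close>

definition weak_compositions :: "nat \<Rightarrow> nat \<Rightarrow> (nat \<Rightarrow> nat) set" where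
  "weak_compositions r u = {l \<in> {1..r} \<rightarrow>\<^sub>E UNIV. (\<Sum>s=1..r. l s) = u}"

text \<open>
  The tuples \<open>(i 1, \<dots>, i (r * k))\<close> of naturals whose \<open>s\<close>-th block of \<open>k\<close> consecutive entries
  sums to \<open>l s\<close>.
\<close>

definition block_compositions :: "nat \<Rightarrow> nat \<Rightarrow> (nat \<Rightarrow> nat) \<Rightarrow> (nat \<Rightarrow> nat) set" where
  "block_compositions k r l =
     {i \<in> {1..r * k} \<rightarrow>\<^sub>E UNIV. \<forall>s\<in>{1..r}. (\<Sum>q = (s - 1) * k + 1..s * k. i q) = l s}"

text \<open>Both index sets are finite, so sums over them are not degenerate.\<close>

lemma finite_weak_compositions: "finite (weak_compositions r u)"
proof (rule finite_subset)
  show "weak_compositions r u \<subseteq> {1..r} \<rightarrow>\<^sub>E {..u}"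
  proof
    fix l assume l: "l \<in> weak_compositions r u"
    have "l s \<le> u" if "s \<in> {1..r}" for s
      using l member_le_sum[of s "{1..r}" l] that by (auto simp: weak_compositions_def)
    then show "l \<in> {1..r} \<rightarrow>\<^sub>E {..u}"
      using l by (auto simp: weak_compositions_def PiE_iff)
  qed
qed (intro finite_PiE; simp)

lemma finite_block_compositions: "finite (block_compositions k r l)"
proof (rule finite_subset)
  let ?m = "\<Sum>s=1..r. l s"
  show "block_compositions k r l \<subseteq> {1..r * k} \<rightarrow>\<^sub>E {..?m}"
  proof
    fix i assume i: "i \<in> block_compositions k r l"
    have "i q \<le> ?m" if q: "q \<in> {1..r * k}" for q
    proof -
      define s where "s = (q - 1) div k + 1"
      have k: "k > 0" using q by (cases k) auto
      have "q - 1 < r * k" using q by auto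
      then have s: "s \<in> {1..r}"
        using k by (simp add: s_def less_mult_imp_div_less Suc_le_eq)
      define d where "d = (q - 1) div k * k"
      have "d \<le> q - 1" by (simp add: d_def)
      moreover have "q - 1 < d + k"
        unfolding d_def using k by (metis add.commute dividend_less_div_times)
      moreover have "(s - 1) * k = d" "s * k = d + k"
        by (simp_all add: s_def d_def)
      ultimately have "q \<in> {(s - 1) * k + 1..s * k}"
        using q by auto
      then have "i q \<le> (\<Sum>q = (s - 1) * k + 1..s * k. i q)"
        by (intro member_le_sum) auto
      also have "\<dots> = l s" using i s by (auto simp: block_compositions_def)
      also have "\<dots> \<le> ?m" using s by (intro member_le_sum) auto
      finally show ?thesis .
    qed
    then show "i \<in> {1..r * k} \<rightarrow>\<^sub>E {..?m}"
      using i by (auto simp: block_compositions_def PiE_iff)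
  qed
qed (intro finite_PiE; simp)

end

theory Submission
  imports Defs
begin

text \<open>
  Substituting \<open>-c t\<close> into the generating function of the Bernoulli numbers gives
  \<open>1 / (1 - e^(-c t)) = 1 / (c t) \<cdot> (\<Sum>i. B i / i! \<cdot> (-c t)^i)\<close>
  for \<open>c \<noteq> 0\<close>. Each of the \<open>r k\<close> factors in the denominator thus contributes a simple pole and a
  power series, so the coefficient of \<open>t^(-1)\<close> of the whole quotient is
  \<open>1 / (a 1 \<cdots> a r)^k\<close> times the coefficient of \<open>t^(r k - 1)\<close> in the product of these
  power series with \<open>e^(n t)\<close> (\<open>polynomial_part_eq_fps_nth\<close>).

  The Cauchy product with \<open>e^(n t)\<close> yields the sum over \<open>u\<close>. The coefficient of \<open>t^u\<close>
  in the product of the Bernoulli series is expanded in two stages: the index tuples \<open>l\<close>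
  distribute the degree \<open>u\<close> over the \<open>r\<close> parts \<open>a s\<close>, and inside the \<open>s\<close>-th part
  the \<open>k\<close> equal factors share the degree \<open>l s\<close>. As all factors of one part carry the same
  scaling, the powers of \<open>-a s\<close> depend on \<open>l\<close> alone and come out of the inner sum, with total
  sign \<open>(-1)^u\<close>. The inner sums of the different parts are independent, so their product is one sum
  over all tuples with prescribed block sums (\<open>sum_PiE_fibres\<close>, \<open>sum_block_compositions\<close>).
\<close>

section \<open>Coefficients of products of power series\<close>

text \<open>
  A choice of one exponent per factor amounts to a multiset of factors with the exponents as
  multiplicities, so this is \<open>fps_prod_nth'\<close> with its multisets replaced by extensional
  functions, the form in which \<open>prod_sum_PiE\<close> applies.
\<close>

lemma fps_nth_prod_PiE:
  fixes F :: "'a \<Rightarrow> 'b::comm_ring_1 fps"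
  assumes "finite A"
  shows "fps_nth (\<Prod>x\<in>A. F x) n =
    (\<Sum>l\<in>{l \<in> A \<rightarrow>\<^sub>E UNIV. (\<Sum>x\<in>A. l x) = n}. \<Prod>x\<in>A. fps_nth (F x) (l x))"
proof -
  let ?m = "\<lambda>l. \<Sum>x\<in>A. replicate_mset (l x) x"
  have count: "count (?m l) x = (if x \<in> A then l x else 0)" for l x
    using assms by (simp add: count_sum)
  have size: "size X = (\<Sum>x\<in>A. count X x)" if "set_mset X \<subseteq> A" for X
    unfolding size_multiset_overloaded_eq using assms that
    by (intro sum.mono_neutral_left) (auto simp: not_in_iff)
  show ?thesis
    unfolding fps_prod_nth'[OF assms]
  proof (rule sum.reindex_bij_witness[where i = ?m and j = "\<lambda>X. restrict (count X) A"])
    fix X assume "X \<in> multisets_of_size A n"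
    then have X: "set_mset X \<subseteq> A" "size X = n"
      by (auto simp: multisets_of_size_def)
    show "?m (restrict (count X) A) = X"
    proof (rule multiset_eqI)
      fix x
      show "count (?m (restrict (count X) A)) x = count X x"
        unfolding count using X(1) by (auto simp: not_in_iff)
    qed
    show "restrict (count X) A \<in> {l \<in> A \<rightarrow>\<^sub>E UNIV. (\<Sum>x\<in>A. l x) = n}"
      using X size by simp
  next
    fix l assume l: "l \<in> {l \<in> A \<rightarrow>\<^sub>E UNIV. (\<Sum>x\<in>A. l x) = n}"
    show "restrict (count (?m l)) A = l"
      using l unfolding count by (auto simp: fun_eq_iff PiE_iff extensional_def)
    have sub: "set_mset (?m l) \<subseteq> A"
      using assms by (auto simp: set_mset_sum)
    show "?m l \<in> multisets_of_size A n"
      using sub size[OF sub] l unfolding count by (simp add: multisets_of_size_def)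
  qed simp
qed

text \<open>
  A function on \<open>Q\<close> is the same as a family of functions on the fibres of \<open>b\<close>. A condition on each
  fibre and a product over \<open>Q\<close> both decouple under this correspondence, so the sum factors; each
  factor is then a coefficient of a product of power series.
\<close>

lemma sum_PiE_fibres:
  fixes g :: "'q \<Rightarrow> nat \<Rightarrow> 'c::comm_ring_1"
  assumes "finite Q" "finite S" "b ` Q \<subseteq> S"
  shows "(\<Sum>i\<in>{i \<in> Q \<rightarrow>\<^sub>E UNIV. \<forall>s\<in>S. (\<Sum>q\<in>{q\<in>Q. b q = s}. i q) = l s}. \<Prod>q\<in>Q. g q (i q)) =
    (\<Prod>s\<in>S. fps_nth (\<Prod>q\<in>{q\<in>Q. b q = s}. Abs_fps (g q)) (l s))"
proof -
  let ?J = "\<lambda>s. {q\<in>Q. b q = s}"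
  let ?C = "\<lambda>s. {i \<in> ?J s \<rightarrow>\<^sub>E UNIV. (\<Sum>q\<in>?J s. i q) = l s}"
  have fin: "finite (?C s)" for s
  proof (rule finite_subset)
    show "?C s \<subseteq> ?J s \<rightarrow>\<^sub>E {..l s}"
    proof
      fix i assume i: "i \<in> ?C s"
      then have "i q \<le> l s" if "q \<in> ?J s" for q
        using member_le_sum[of q "?J s" i] that assms(1) by auto
      then show "i \<in> ?J s \<rightarrow>\<^sub>E {..l s}"
        using i by (auto simp: PiE_iff)
    qed
  qed (use assms(1) in \<open>intro finite_PiE; simp\<close>)
  have "(\<Prod>s\<in>S. fps_nth (\<Prod>q\<in>?J s. Abs_fps (g q)) (l s)) =
      (\<Prod>s\<in>S. \<Sum>i\<in>?C s. \<Prod>q\<in>?J s. g q (i q))"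
    using assms(1) by (subst fps_nth_prod_PiE) simp_all
  also have "\<dots> = (\<Sum>h\<in>PiE S ?C. \<Prod>s\<in>S. \<Prod>q\<in>?J s. g q (h s q))"
    using assms(2) fin by (rule prod_sum_PiE)
  also have "\<dots> = (\<Sum>i\<in>{i \<in> Q \<rightarrow>\<^sub>E UNIV. \<forall>s\<in>S. (\<Sum>q\<in>?J s. i q) = l s}. \<Prod>q\<in>Q. g q (i q))"
  proof (rule sum.reindex_bij_witness[where
        i = "\<lambda>i. \<lambda>s\<in>S. restrict i (?J s)" and j = "\<lambda>h. \<lambda>q\<in>Q. h (b q) q"])
    fix h assume h: "h \<in> PiE S ?C"
    have hC: "h s \<in> ?C s" if "s \<in> S" for s
      using h that by blast
    show "(\<lambda>s\<in>S. restrict (\<lambda>q\<in>Q. h (b q) q) (?J s)) = h"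
    proof
      fix s
      show "(\<lambda>s\<in>S. restrict (\<lambda>q\<in>Q. h (b q) q) (?J s)) s = h s"
      proof (cases "s \<in> S")
        case True
        then have "h s \<in> extensional (?J s)" using hC by (auto simp: PiE_iff)
        then show ?thesis using True by (auto simp: extensional_def fun_eq_iff)
      next
        case False
        then show ?thesis using h by (auto simp: PiE_iff extensional_def)
      qed
    qed
    show "(\<lambda>q\<in>Q. h (b q) q) \<in> {i \<in> Q \<rightarrow>\<^sub>E UNIV. \<forall>s\<in>S. (\<Sum>q\<in>?J s. i q) = l s}"
      using hC by (auto simp: PiE_iff)
    have "(\<Prod>s\<in>S. \<Prod>q\<in>?J s. g q (h s q)) = (\<Prod>s\<in>S. \<Prod>q\<in>?J s. g q ((\<lambda>q\<in>Q. h (b q) q) q))"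
      by (intro prod.cong) auto
    also have "\<dots> = (\<Prod>q\<in>Q. g q ((\<lambda>q\<in>Q. h (b q) q) q))"
      using assms by (rule prod.group)
    finally show "(\<Prod>q\<in>Q. g q ((\<lambda>q\<in>Q. h (b q) q) q)) = (\<Prod>s\<in>S. \<Prod>q\<in>?J s. g q (h s q))" ..
  next
    fix i assume i: "i \<in> {i \<in> Q \<rightarrow>\<^sub>E UNIV. \<forall>s\<in>S. (\<Sum>q\<in>?J s. i q) = l s}"
    show "(\<lambda>q\<in>Q. (\<lambda>s\<in>S. restrict i (?J s)) (b q) q) = i"
      using i assms(3) by (auto simp: fun_eq_iff PiE_iff extensional_def)
    show "(\<lambda>s\<in>S. restrict i (?J s)) \<in> PiE S ?C"
      using i by auto
  qed
  finally show ?thesis ..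
qed

lemma sum_block_compositions:
  fixes g :: "nat \<Rightarrow> 'c::comm_ring_1"
  assumes "k > 0"
  shows "(\<Sum>i\<in>block_compositions k r l. \<Prod>q=1..r * k. g (i q)) =
    (\<Prod>s=1..r. fps_nth (Abs_fps g ^ k) (l s))"
proof -
  \<comment> \<open>The index of the block containing \<open>q\<close>; positions and blocks are both counted from 1.\<close>
  define b where "b q = (q - 1) div k + 1" for q
  have block: "{q \<in> {1..r * k}. b q = s} = {(s - 1) * k + 1..s * k}" if "s \<in> {1..r}" for s
  proof -
    define t where "t = s - 1"
    have t: "s = Suc t" using that by (simp add: t_def)
    have "t * k + k \<le> r * k"
      using that mult_le_mono1[of "Suc t" r k] by (simp add: t)
    moreover have "b q = s \<longleftrightarrow> t * k + 1 \<le> q \<and> q \<le> t * k + k" if "q \<ge> 1" for q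
    proof -
      have "b q = s \<longleftrightarrow> t \<le> (q - 1) div k \<and> (q - 1) div k < Suc t"
        by (auto simp: b_def t)
      also have "\<dots> \<longleftrightarrow> t * k \<le> q - 1 \<and> q - 1 < Suc t * k"
        using assms by (simp only: less_eq_div_iff_mult_less_eq div_less_iff_less_mult)
      finally show ?thesis using that by auto
    qed
    ultimately show ?thesis by (auto simp: t)
  qed
  have "b ` {1..r * k} \<subseteq> {1..r}"
    using assms by (auto simp: b_def Suc_le_eq intro!: less_mult_imp_div_less)
  from sum_PiE_fibres[OF _ _ this, of "\<lambda>_. g" l]
  have "(\<Sum>i\<in>{i \<in> {1..r * k} \<rightarrow>\<^sub>E UNIV. \<forall>s\<in>{1..r}. (\<Sum>q\<in>{q\<in>{1..r * k}. b q = s}. i q) = l s}.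
      \<Prod>q=1..r * k. g (i q)) = (\<Prod>s=1..r. Abs_fps g ^ card {q \<in> {1..r * k}. b q = s} $ l s)"
    by simp
  moreover have "card {q \<in> {1..r * k}. b q = s} = k" if "s \<in> {1..r}" for s
    unfolding block[OF that] using that by (cases s) auto
  moreover have "block_compositions k r l = {i \<in> {1..r * k} \<rightarrow>\<^sub>E UNIV.
      \<forall>s\<in>{1..r}. (\<Sum>q\<in>{q\<in>{1..r * k}. b q = s}. i q) = l s}"
    unfolding block_compositions_def by (rule Collect_cong) (simp only: block cong: ball_cong)
  ultimately show ?thesis
    by simp
qed

section \<open>The Bernoulli series\<close>

definition bernoulli_fps :: "complex fps" where
  "bernoulli_fps = Abs_fps (\<lambda>i. of_real (bernoulli i / fact i))"

lemma bernoulli_fps_mult: "bernoulli_fps * (fps_exp 1 - 1) = fps_X"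
proof (rule fps_ext)
  fix n
  have "fps_nth (bernoulli_fps * (fps_exp 1 - 1)) n =
      of_real (fps_nth (Abs_fps (\<lambda>i. bernoulli i / fact i) * (fps_exp 1 - 1)) n)"
    by (auto simp: fps_mult_nth bernoulli_fps_def intro!: sum.cong)
  also have "\<dots> = fps_nth fps_X n"
    unfolding bernoulli_generating_function by simp
  finally show "fps_nth (bernoulli_fps * (fps_exp 1 - 1)) n = fps_nth fps_X n" .
qed

text \<open>
  Substitute \<open>-c t\<close> for \<open>t\<close> in the generating function and change signs. For \<open>c \<noteq> 0\<close> this says
  that \<open>1 / (1 - e^(-c t))\<close> is the scaled Bernoulli series divided by \<open>c t\<close>.
\<close>

lemma bernoulli_fps_compose_mult:
  "(bernoulli_fps oo (fps_const (- c) * fps_X)) * (1 - fps_exp (- c)) = fps_const c * fps_X"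
proof -
  let ?Y = "fps_const (- c) * fps_X"
  have "(bernoulli_fps oo ?Y) * (fps_exp (- c) - 1) = (bernoulli_fps * (fps_exp 1 - 1)) oo ?Y"
    by (simp add: fps_compose_mult_distrib fps_compose_sub_distrib)
  also have "\<dots> = ?Y"
    by (simp add: bernoulli_fps_mult)
  finally have "- ((bernoulli_fps oo ?Y) * (fps_exp (- c) - 1)) = - ?Y"
    by simp
  then show ?thesis
    by (simp add: algebra_simps flip: fps_const_neg)
qed

text \<open>
  Substituting \<open>-a s \<cdot> t\<close> multiplies the coefficient of degree \<open>l s\<close> by \<open>(-a s)^(l s)\<close>. Since the
  \<open>l s\<close> add up to \<open>u\<close>, the signs combine to \<open>(-1)^u\<close>.
\<close>

lemma fps_nth_prod_bernoulli_fps_compose: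
  assumes "k > 0"
  shows "fps_nth (\<Prod>s=1..r. (bernoulli_fps oo (fps_const (- of_nat (a s)) * fps_X)) ^ k) u =
    of_real ((-1) ^ u * (\<Sum>l\<in>weak_compositions r u. (\<Prod>s=1..r. real (a s) ^ l s) *
      (\<Sum>i\<in>block_compositions k r l.
        (\<Prod>q=1..r * k. bernoulli (i q)) / (\<Prod>q=1..r * k. fact (i q)))))"
proof -
  have "fps_nth (\<Prod>s=1..r. (bernoulli_fps oo (fps_const (- of_nat (a s)) * fps_X)) ^ k) u =
      (\<Sum>l\<in>weak_compositions r u. \<Prod>s=1..r. (- of_nat (a s)) ^ l s * fps_nth (bernoulli_fps ^ k) (l s))"
    by (simp add: fps_nth_prod_PiE weak_compositions_def fps_compose_power)
  also have "\<dots> = (\<Sum>l\<in>weak_compositions r u. (-1) ^ u * ((\<Prod>s=1..r. of_nat (a s) ^ l s) *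
      (\<Prod>s=1..r. fps_nth (bernoulli_fps ^ k) (l s))))"
  proof (rule sum.cong[OF refl])
    fix l assume "l \<in> weak_compositions r u"
    then have u: "(\<Sum>s=1..r. l s) = u" by (simp add: weak_compositions_def)
    have "(- of_nat (a s) :: complex) ^ l s = (-1) ^ l s * of_nat (a s) ^ l s" for s
      by (rule power_minus)
    then show "(\<Prod>s=1..r. (- of_nat (a s)) ^ l s * fps_nth (bernoulli_fps ^ k) (l s)) =
        (-1) ^ u * ((\<Prod>s=1..r. of_nat (a s) ^ l s) * (\<Prod>s=1..r. fps_nth (bernoulli_fps ^ k) (l s)))"
      by (simp add: prod.distrib power_sum flip: u)
  qed
  also have "\<dots> = (\<Sum>l\<in>weak_compositions r u. (-1) ^ u * ((\<Prod>s=1..r. of_nat (a s) ^ l s) *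
      (\<Sum>i\<in>block_compositions k r l. \<Prod>q=1..r * k. of_real (bernoulli (i q) / fact (i q)))))"
    unfolding bernoulli_fps_def
      sum_block_compositions[OF assms, of "\<lambda>i. of_real (bernoulli i / fact i)"] ..
  also have "\<dots> = of_real ((-1) ^ u * (\<Sum>l\<in>weak_compositions r u. (\<Prod>s=1..r. real (a s) ^ l s) *
      (\<Sum>i\<in>block_compositions k r l.
        (\<Prod>q=1..r * k. bernoulli (i q)) / (\<Prod>q=1..r * k. fact (i q)))))"
    by (simp add: prod_dividef sum_distrib_left)
  finally show ?thesis .
qed

section \<open>The residue\<close>

lemma fps_const_prod: "(\<Prod>x\<in>A. fps_const (f x :: 'b::comm_ring_1)) = fps_const (\<Prod>x\<in>A. f x)"
  by (induction A rule: infinite_finite_induct) auto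

lemma fps_to_fls_prod:
  "fps_to_fls (\<Prod>x\<in>A. F x :: 'b::comm_ring_1 fps) = (\<Prod>x\<in>A. fps_to_fls (F x))"
  by (induction A rule: infinite_finite_induct) (auto simp: fls_times_fps_to_fls)

text \<open>
  This is where the analytic definition is reduced to formal power series: a Laurent expansion is
  compatible with products and quotients, and the denominator is \<open>t^(r k)\<close> times a constant,
  divided by the product of the Bernoulli series. Positivity of the \<open>a i\<close> makes that constant
  nonzero.
\<close>

lemma polynomial_part_eq_fps_nth:
  assumes "r * k > 0" and pos: "\<And>i. i \<in> {1..r} \<Longrightarrow> a i > 0"
  shows "polynomial_part k r a n = fps_nth
    ((\<Prod>i=1..r. (bernoulli_fps oo (fps_const (- of_nat (a i)) * fps_X)) ^ k) * fps_exp (of_nat n))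
    (r * k - 1) / (\<Prod>i=1..r. of_nat (a i)) ^ k"
proof -
  define A :: complex where "A = (\<Prod>i=1..r. of_nat (a i)) ^ k"
  define D :: "complex fps" where "D = (\<Prod>i=1..r. (1 - fps_exp (- of_nat (a i))) ^ k)"
  define G where "G = (\<Prod>i=1..r. (bernoulli_fps oo (fps_const (- of_nat (a i)) * fps_X)) ^ k)"
  define E :: "complex fps" where "E = fps_exp (of_nat n)"
  have A: "A \<noteq> 0"
    using pos by (force simp: A_def)
  have "G * D = (\<Prod>i=1..r. (fps_const (of_nat (a i)) * fps_X) ^ k)"
    by (simp add: G_def D_def bernoulli_fps_compose_mult flip: prod.distrib power_mult_distrib)
  also have "\<dots> = fps_const A * fps_X ^ (r * k)"
    by (simp add: A_def power_mult_distrib prod.distrib fps_const_prod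
        mult.commute flip: power_mult prod_power_distrib)
  finally have GD: "G * D = fps_const A * fps_X ^ (r * k)" .
  have D: "D \<noteq> 0"
    using GD A by auto
  have GD_fls: "fps_to_fls G * fps_to_fls D = fls_const A * fls_X ^ (r * k)"
    using arg_cong[OF GD, of fps_to_fls] by (simp add: fls_times_fps_to_fls fps_to_fls_power)
  have "fls_const (inverse A) * fps_to_fls (G * E) * fps_to_fls D =
      fps_to_fls E * fls_const (inverse A) * (fps_to_fls G * fps_to_fls D)"
    by (simp only: fls_times_fps_to_fls mult_ac)
  also have "\<dots> = fps_to_fls E * (fls_const (inverse A) * fls_const A) * fls_X ^ (r * k)"
    unfolding GD_fls by (simp only: mult_ac)
  also have "fls_const (inverse A) * fls_const A = 1"
    using A by simp
  finally have quotient: "fps_to_fls E / fps_to_fls D =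
      fls_const (inverse A) * fps_to_fls (G * E) / fls_X ^ (r * k)"
    using D by (simp add: frac_eq_eq del: fls_divide_X_power)
  have factor: "(\<lambda>t. 1 - exp (- (of_nat (a i) * t))) has_laurent_expansion
      fps_to_fls (1 - fps_exp (- of_nat (a i)))" for i
    using has_fps_expansion_exp[of "- of_nat (a i) :: complex"]
    by (intro has_laurent_expansion_fps fps_expansion_intros) simp
  have "(\<lambda>t. exp (of_nat n * t) / (\<Prod>i=1..r. (1 - exp (- (of_nat (a i) * t))) ^ k))
      has_laurent_expansion
      fps_to_fls E / (\<Prod>i=1..r. fps_to_fls (1 - fps_exp (- of_nat (a i))) ^ k)"
    unfolding E_def
    by (intro has_laurent_expansion_divide has_laurent_expansion_prod has_laurent_expansion_power
        factor has_laurent_expansion_fps has_fps_expansion_exp)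
  also have "(\<Prod>i=1..r. fps_to_fls (1 - fps_exp (- of_nat (a i))) ^ k) = fps_to_fls D"
    by (simp add: D_def fps_to_fls_prod fps_to_fls_power)
  finally have "polynomial_part k r a n = fls_nth (fps_to_fls E / fps_to_fls D) (-1)"
    unfolding polynomial_part_def by (simp add: laurent_expansion_0_eqI)
  also have "\<dots> = inverse A * fls_nth (fps_to_fls (G * E)) (- 1 + int (r * k))"
    unfolding quotient by simp
  also have "- 1 + int (r * k) = int (r * k - 1)"
    using assms(1) by (simp add: of_nat_diff del: of_nat_mult)
  also have "inverse A * fls_nth (fps_to_fls (G * E)) (int (r * k - 1)) =
      fps_nth (G * E) (r * k - 1) / A"
    by (simp add: field_simps del: of_nat_mult of_nat_diff)
  finally show ?thesis
    by (simp add: G_def E_def A_def)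
qed

theorem theorem4p3:
  fixes r k n :: nat and a :: "nat \<Rightarrow> nat"
  assumes "r \<ge> 1" and "k \<ge> 2" and "\<And>i. i \<in> {1..r} \<Longrightarrow> a i > 0"
  shows "polynomial_part k r a n = complex_of_real
    (1 / real (\<Prod>i=1..r. a i) ^ k *
      (\<Sum>u=0..r * k - 1. (-1) ^ u / fact (r * k - 1 - u) * real n ^ (r * k - 1 - u) *
        (\<Sum>l\<in>weak_compositions r u. (\<Prod>s=1..r. real (a s) ^ l s) *
          (\<Sum>i\<in>block_compositions k r l.
            (\<Prod>q=1..r * k. bernoulli (i q)) / (\<Prod>q=1..r * k. fact (i q))))))"
proof -
  define S where "S u = (\<Sum>l\<in>weak_compositions r u. (\<Prod>s=1..r. real (a s) ^ l s) *
          (\<Sum>i\<in>block_compositions k r l.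
            (\<Prod>q=1..r * k. bernoulli (i q)) / (\<Prod>q=1..r * k. fact (i q))))" for u
  have k: "k > 0" and rk: "r * k > 0"
    using assms(1,2) by auto
  have "polynomial_part k r a n =
      (\<Sum>u=0..r * k - 1. of_real ((-1) ^ u * S u) *
        (of_nat n ^ (r * k - 1 - u) / fact (r * k - 1 - u))) / (\<Prod>i=1..r. of_nat (a i)) ^ k"
    by (subst polynomial_part_eq_fps_nth[OF rk assms(3)], assumption)
      (simp only: fps_mult_nth S_def fps_nth_prod_bernoulli_fps_compose[OF k] fps_exp_nth of_nat_fact)
  also have "\<dots> = of_real (1 / real (\<Prod>i=1..r. a i) ^ k *
      (\<Sum>u=0..r * k - 1. (-1) ^ u / fact (r * k - 1 - u) * real n ^ (r * k - 1 - u) * S u))"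
    by (simp add: sum_distrib_left sum_divide_distrib mult_ac)
  finally show ?thesis
    unfolding S_def .
qed

end
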